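(* Let $\Omega,a\in\mathbb R$. Let $\mathbf x:\mathbb R\to\mathbb S^2$ be a smooth solution of $$\mathbf x\times\mathbf x''-\Omega e_3\times\mathbf x+a\mathbf x'=0.\qquad(1)$$ Let $\mathbf X_0$ be any primitive of $\mathbf x$, namely $\mathbf X_0'=\mathbf x$. Then the quantity $$\mathbf d:=\mathbf x\times\mathbf x'-\Omega e_3\times\mathbf X_0+a\mathbf x$$ is independent of $\xi$. If $\mathbf b$ solves $\mathbf b'(t)=\mathscr R^{\Omega t}\mathbf d$, then $$\mathbf X(t,s)=\mathscr R^{\Omega t}\mathbf X_0(s-at)+\mathbf b(t)$$ solves the Vortex Filament Equation $\mathbf X_t=\mathbf X_s\times\mathbf X_{ss}$ on $\mathbb R^2$, and its tangent field is $\mathbf X_s(t,s)=\mathscr R^{\Omega t}\mathbf x(s-at)$. Conversely, if a filament of the form $\mathbf X(t,s)=\mathscr R^{\Omega t}\mathbf X_0(s-at)+\mathbf b(t)$, with $\mathbf X_0:\mathbb R\to\mathbb R^3$ a profile curve and $\mathbf b:\mathbb R\to\mathbb R^3$ a time-dependent translation, solves $\mathbf X_t=\mathbf X_s\times\mathbf X_{ss}$ and satisfies $\mathbf X_0'=\mathbf x$ (with $\mathbf x:\mathbb R\to\mathbb S^2$ smooth), then there exists a constant vector $\mathbf d\in\mathbb R^3$ such that $$\mathbf x\times\mathbf x'-\Omega e_3\times\mathbf X_0+a\mathbf x=\mathbf d,\qquad \mathbf X_0'=\mathbf x,$$ and the tangent profile $\mathbf x$ satisfies (1).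
   Context: $e_3=(0,0,1)$, $\mathbb S^2$ is the unit sphere of $\mathbb R^3$, $\mathscr R^{\Omega t}$ is the rotation of angle $\Omega t$ around the $x_3$-axis, i.e. $\mathscr R^{\Omega t}(y_1,y_2,y_3)=(\cos(\Omega t)y_1-\sin(\Omega t)y_2,\ \sin(\Omega t)y_1+\cos(\Omega t)y_2,\ y_3)$. Primes on $\mathbf x,\mathbf X_0$ are derivatives in the profile variable $\xi$ ($=s-at$). *)

theory Defs
  imports "HOL-Analysis.Analysis"
begin

definition vderiv :: "(real \<Rightarrow> 'a::real_normed_vector) \<Rightarrow> real \<Rightarrow> 'a" where
  "vderiv f = (\<lambda>\<xi>. vector_derivative f (at \<xi>))"

definition smooth_curve :: "(real \<Rightarrow> 'a::real_normed_vector) \<Rightarrow> bool" where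
  "smooth_curve f \<longleftrightarrow> (\<forall>n \<xi>. (vderiv ^^ n) f differentiable (at \<xi>))"

definition e3 :: "real ^ 3" where
  "e3 = vector [0, 0, 1]"

definition rot3 :: "real \<Rightarrow> real ^ 3 \<Rightarrow> real ^ 3" where
  "rot3 \<theta> y = vector [cos \<theta> * y $ 1 - sin \<theta> * y $ 2,
                    sin \<theta> * y $ 1 + cos \<theta> * y $ 2,
                    y $ 3]"

text \<open>The derivatives are required to exist at every point of the plane, with no continuity imposed
  on them and no regularity of \<^term>\<open>X\<close> as a function of both variables jointly.\<close>

definition solves_VFE :: "(real \<Rightarrow> real \<Rightarrow> real ^ 3) \<Rightarrow> bool" where
  "solves_VFE X \<longleftrightarrow>
     (\<exists>Xt Xs Xss. \<forall>t s.
        ((\<lambda>t'. X t' s) has_vector_derivative Xt t s) (at t) \<and>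
        ((\<lambda>s'. X t s') has_vector_derivative Xs t s) (at s) \<and>
        ((\<lambda>s'. Xs t s') has_vector_derivative Xss t s) (at s) \<and>
        Xt t s = cross3 (Xs t s) (Xss t s))"

definition profile_eq :: "real \<Rightarrow> real \<Rightarrow> (real \<Rightarrow> real ^ 3) \<Rightarrow> bool" where
  "profile_eq \<Omega> a x \<longleftrightarrow>
     (\<forall>\<xi>. cross3 (x \<xi>) (vderiv (vderiv x) \<xi>) - \<Omega> *\<^sub>R cross3 e3 (x \<xi>) + a *\<^sub>R vderiv x \<xi> = 0)"

definition profile_quantity ::
    "real \<Rightarrow> real \<Rightarrow> (real \<Rightarrow> real ^ 3) \<Rightarrow> (real \<Rightarrow> real ^ 3) \<Rightarrow> real \<Rightarrow> real ^ 3" where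
  "profile_quantity \<Omega> a x X\<^sub>0 \<xi> =
     cross3 (x \<xi>) (vderiv x \<xi>) - \<Omega> *\<^sub>R cross3 e3 (X\<^sub>0 \<xi>) + a *\<^sub>R x \<xi>"

definition filament ::
    "real \<Rightarrow> real \<Rightarrow> (real \<Rightarrow> real ^ 3) \<Rightarrow> (real \<Rightarrow> real ^ 3) \<Rightarrow> real \<Rightarrow> real \<Rightarrow> real ^ 3" where
  "filament \<Omega> a X\<^sub>0 b t s = rot3 (\<Omega> * t) (X\<^sub>0 (s - a * t)) + b t"

end

theory Submission
  imports Defs
begin

(* Differentiating the quantity Q along the profile gives the left-hand side of the profile equation,
   so that equation says that Q is constant.  For the filament, commuting the rotation with the cross
   product turns the Vortex Filament Equation at (t, s) into b'(t) = R (Q (s - a t)), R being the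
   rotation by the angle \<Omega> t; taking t = 0 shows that Q is constant. *)

text \<open>A rotation preserves lengths and orientation. In coordinates only the third component
  needs more than rearrangement: it is a planar determinant, scaled by the determinant cos^2 + sin^2
  = 1 of the rotation.\<close>

lemma rot3_cross3: "rot3 \<theta> (cross3 u v) = cross3 (rot3 \<theta> u) (rot3 \<theta> v)"
proof -
  have "(cos \<theta> * p - sin \<theta> * q) * (sin \<theta> * r + cos \<theta> * w) -
      (sin \<theta> * p + cos \<theta> * q) * (cos \<theta> * r - sin \<theta> * w) =
      (cos \<theta> * cos \<theta> + sin \<theta> * sin \<theta>) * (p * w - q * r)" for p q r w
    \<comment> \<open>The factor cos^2 + sin^2 stays unevaluated here, so that both sides expand to
      the same polynomial.\<close>
    by (simp add: algebra_simps del: sin_cos_squared_add3)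
  then show ?thesis
    by (simp add: rot3_def cross3_def vec_eq_iff forall_3 vector_3) (simp add: algebra_simps)
qed

text \<open>Rodrigues' formula with axis \<open>e3\<close>. The angle now occurs only in scalar
  coefficients, so product rules suffice to differentiate in it.\<close>

lemma rot3_Rodrigues:
  "rot3 \<theta> y = y + sin \<theta> *\<^sub>R cross3 e3 y + (1 - cos \<theta>) *\<^sub>R cross3 e3 (cross3 e3 y)"
  by (simp add: rot3_def e3_def cross3_def vec_eq_iff forall_3 vector_3 algebra_simps)

lemma linear_rot3: "linear (rot3 \<theta>)"
  by (rule linearI) (simp_all add: rot3_def vec_eq_iff forall_3 vector_3 algebra_simps)

lemma bounded_linear_rot3: "bounded_linear (rot3 \<theta>)"
  using linear_rot3 linear_conv_bounded_linear by blast

lemma rot3_0 [simp]: "rot3 0 y = y"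
  by (simp add: rot3_Rodrigues)

text \<open>\<open>cross3 e3\<close> kills the axis and is a quarter turn of the horizontal plane,
  so its square is -1 on its range.\<close>

lemma cross3_e3_cubed: "cross3 e3 (cross3 e3 (cross3 e3 y)) = - cross3 e3 y"
  by (simp add: e3_def cross3_def vec_eq_iff forall_3 vector_3)

lemmas has_vector_derivative_cross3 =
  bounded_bilinear.has_vector_derivative[OF bilinear_cross[unfolded bilinear_conv_bounded_bilinear]]

text \<open>The generator \<open>cross3 e3\<close> commutes with the rotation, so the contribution
  of the turning frame can be written inside \<open>rot3\<close>, next to \<open>f'\<close>.\<close>

lemma has_vector_derivative_rot3:
  assumes f: "(f has_vector_derivative f') (at t)"
  shows "((\<lambda>t. rot3 (\<Omega> * t) (f t)) has_vector_derivative
           rot3 (\<Omega> * t) (\<Omega> *\<^sub>R cross3 e3 (f t) + f')) (at t)"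
proof -
  have e: "((\<lambda>t. cross3 e3 (g t)) has_vector_derivative cross3 e3 g') (at t)"
    if "(g has_vector_derivative g') (at t)" for g g'
    using has_vector_derivative_cross3[OF has_vector_derivative_const that, of e3] by simp
  have s: "((\<lambda>t. sin (\<Omega> * t)) has_field_derivative \<Omega> * cos (\<Omega> * t)) (at t)"
    and c: "((\<lambda>t. 1 - cos (\<Omega> * t)) has_field_derivative \<Omega> * sin (\<Omega> * t)) (at t)"
    by (auto intro!: derivative_eq_intros)
  have "((\<lambda>t. rot3 (\<Omega> * t) (f t)) has_vector_derivative
      f' + (sin (\<Omega> * t) *\<^sub>R cross3 e3 f' + (\<Omega> * cos (\<Omega> * t)) *\<^sub>R cross3 e3 (f t)) +
      ((1 - cos (\<Omega> * t)) *\<^sub>R cross3 e3 (cross3 e3 f') +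
       (\<Omega> * sin (\<Omega> * t)) *\<^sub>R cross3 e3 (cross3 e3 (f t)))) (at t)"
    unfolding rot3_Rodrigues
    by (intro has_vector_derivative_add has_vector_derivative_scaleR f e s c)
  \<comment> \<open>With K = \<open>cross3 e3\<close> and K^3 = -K, the rotation of K y is cos K y +
    sin K^2 y, which absorbs the two terms coming from the scalar coefficients.\<close>
  then show ?thesis
    by (simp add: rot3_Rodrigues cross3_e3_cubed cross_add_right cross_mult_right algebra_simps)
qed

lemma has_vector_derivative_affine_arg:
  assumes "(f has_vector_derivative f') (at (c + k * t))"
  shows "((\<lambda>u. f (c + k * u)) has_vector_derivative k *\<^sub>R f') (at t)"
proof -
  have "((\<lambda>u. c + k * u) has_vector_derivative k) (at t)"
    by (auto intro!: derivative_eq_intros simp flip: has_real_derivative_iff_has_vector_derivative)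
  from vector_diff_chain_at[OF this assms] show ?thesis
    by (simp add: o_def)
qed

lemma rotated_profile_has_space_derivative:
  assumes "(f has_vector_derivative f') (at (s - c))"
  shows "((\<lambda>s. rot3 \<theta> (f (s - c))) has_vector_derivative rot3 \<theta> f') (at s)"
proof -
  have "((\<lambda>u. f (- c + 1 * u)) has_vector_derivative 1 *\<^sub>R f') (at s)"
    by (rule has_vector_derivative_affine_arg) (use assms in simp)
  then have "((\<lambda>s. f (s - c)) has_vector_derivative f') (at s)"
    by simp
  then show ?thesis
    by (rule bounded_linear.has_vector_derivative[OF bounded_linear_rot3])
qed

lemma rotated_profile_has_time_derivative:
  assumes "(X\<^sub>0 has_vector_derivative x) (at (s - a * t))"
  shows "((\<lambda>t. rot3 (\<Omega> * t) (X\<^sub>0 (s - a * t))) has_vector_derivative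
           rot3 (\<Omega> * t) (\<Omega> *\<^sub>R cross3 e3 (X\<^sub>0 (s - a * t)) - a *\<^sub>R x)) (at t)"
proof -
  have "((\<lambda>u. X\<^sub>0 (s + (- a) * u)) has_vector_derivative (- a) *\<^sub>R x) (at t)"
    by (rule has_vector_derivative_affine_arg) (use assms in simp)
  from has_vector_derivative_rot3[OF this] show ?thesis
    by simp
qed

lemma filament_has_space_derivative:
  assumes "(X\<^sub>0 has_vector_derivative x) (at (s - a * t))"
  shows "((\<lambda>s. filament \<Omega> a X\<^sub>0 b t s) has_vector_derivative rot3 (\<Omega> * t) x) (at s)"
  unfolding filament_def has_vector_derivative_add_const
  using assms by (rule rotated_profile_has_space_derivative)

text \<open>The filament and \<open>b\<close> differ by a function differentiable in time, so
  differentiability passes both ways and that of \<open>b\<close> need not be assumed.\<close>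

lemma filament_has_time_derivative_iff:
  assumes "(X\<^sub>0 has_vector_derivative x) (at (s - a * t))"
  shows "((\<lambda>t. filament \<Omega> a X\<^sub>0 b t s) has_vector_derivative
            rot3 (\<Omega> * t) (\<Omega> *\<^sub>R cross3 e3 (X\<^sub>0 (s - a * t)) - a *\<^sub>R x) + b') (at t) \<longleftrightarrow>
         (b has_vector_derivative b') (at t)"
    (is "?L \<longleftrightarrow> ?R")
proof
  note r = rotated_profile_has_time_derivative[OF assms, of \<Omega>]
  show ?R if ?L
    using has_vector_derivative_diff[OF that r] by (simp add: filament_def)
  show ?L if ?R
    using has_vector_derivative_add[OF r that] by (simp add: filament_def)
qed

lemma smooth_curve_has_vector_derivative:
  assumes "smooth_curve x"
  shows "((vderiv ^^ n) x has_vector_derivative (vderiv ^^ Suc n) x \<xi>) (at \<xi>)"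
  using assms by (simp add: smooth_curve_def vderiv_def vector_derivative_works)

text \<open>Serves both directions of the theorem. The right-hand side asks for one derivative of
  \<open>b\<close> at each time, given by every \<xi> at once.\<close>

lemma solves_VFE_filament_iff:
  assumes x: "\<And>\<xi>. (x has_vector_derivative x' \<xi>) (at \<xi>)"
    and X\<^sub>0: "\<And>\<xi>. (X\<^sub>0 has_vector_derivative x \<xi>) (at \<xi>)"
  shows "solves_VFE (filament \<Omega> a X\<^sub>0 b) \<longleftrightarrow>
         (\<forall>t \<xi>. (b has_vector_derivative rot3 (\<Omega> * t) (profile_quantity \<Omega> a x X\<^sub>0 \<xi>)) (at t))"
    (is "_ \<longleftrightarrow> (\<forall>t \<xi>. ?B t \<xi>)")
proof -
  have x'_eq: "vderiv x \<xi> = x' \<xi>" for \<xi>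
    using x by (simp add: vderiv_def vector_derivative_at)
  \<comment> \<open>The definition of the quantity, solved for the cross product: the first summand
    is the velocity of the rotated profile, which leaves the second for \<open>b\<close>.\<close>
  have "rot3 (\<Omega> * t) (cross3 (x \<xi>) (x' \<xi>)) =
      rot3 (\<Omega> * t) (\<Omega> *\<^sub>R cross3 e3 (X\<^sub>0 \<xi>) - a *\<^sub>R x \<xi>) +
      rot3 (\<Omega> * t) (profile_quantity \<Omega> a x X\<^sub>0 \<xi>)" for t \<xi>
    by (simp add: profile_quantity_def x'_eq flip: linear_add[OF linear_rot3])
  then have time: "((\<lambda>t. filament \<Omega> a X\<^sub>0 b t s) has_vector_derivative
        cross3 (rot3 (\<Omega> * t) (x (s - a * t))) (rot3 (\<Omega> * t) (x' (s - a * t)))) (at t)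
      \<longleftrightarrow> ?B t (s - a * t)" for t s
    using filament_has_time_derivative_iff[OF X\<^sub>0] by (simp flip: rot3_cross3)
  note space = filament_has_space_derivative[OF X\<^sub>0]
    rotated_profile_has_space_derivative[OF x]
  show ?thesis
  proof
    assume "solves_VFE (filament \<Omega> a X\<^sub>0 b)"
    then obtain Xt Xs Xss where
      Xt: "\<And>t s. ((\<lambda>t. filament \<Omega> a X\<^sub>0 b t s) has_vector_derivative Xt t s) (at t)" and
      Xs: "\<And>t s. ((\<lambda>s. filament \<Omega> a X\<^sub>0 b t s) has_vector_derivative Xs t s) (at s)" and
      Xss: "\<And>t s. ((\<lambda>s. Xs t s) has_vector_derivative Xss t s) (at s)" and
      eq: "\<And>t s. Xt t s = cross3 (Xs t s) (Xss t s)"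
      unfolding solves_VFE_def by metis
    \<comment> \<open>The functions obtained are arbitrary; uniqueness of derivatives identifies
      them with the rotated tangent and its derivative.\<close>
    have "Xs = (\<lambda>t s. rot3 (\<Omega> * t) (x (s - a * t)))"
      using vector_derivative_unique_at[OF Xs space(1)] by blast
    moreover from this have "Xss = (\<lambda>t s. rot3 (\<Omega> * t) (x' (s - a * t)))"
      using vector_derivative_unique_at[OF Xss] space(2) by blast
    ultimately have B: "?B t (s - a * t)" for t s
      using Xt[of s t] by (simp add: eq time)
    show "\<forall>t \<xi>. ?B t \<xi>"
    proof (intro allI)
      show "?B t \<xi>" for t \<xi>
        \<comment> \<open>At each time, s = \<xi> + a t makes the profile variable equal to any
          prescribed \<xi>.\<close>
        using B[of t "\<xi> + a * t"] by simp
    qed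
  next
    assume "\<forall>t \<xi>. ?B t \<xi>"
    then show "solves_VFE (filament \<Omega> a X\<^sub>0 b)"
      unfolding solves_VFE_def
      by (intro exI[of _ "\<lambda>t s. rot3 (\<Omega> * t) (x (s - a * t))"]
          exI[of _ "\<lambda>t s. rot3 (\<Omega> * t) (x' (s - a * t))"]
          exI[of _ "\<lambda>t s. cross3 (rot3 (\<Omega> * t) (x (s - a * t))) (rot3 (\<Omega> * t) (x' (s - a * t)))"])
         (simp add: time space)
  qed
qed

text \<open>A curve on the whole line is constant exactly when its derivative vanishes
  everywhere.\<close>

lemma profile_quantity_constant_iff:
  assumes x: "smooth_curve x"
    and X\<^sub>0: "\<And>\<xi>. (X\<^sub>0 has_vector_derivative x \<xi>) (at \<xi>)"
  shows "profile_eq \<Omega> a x \<longleftrightarrow> (\<exists>d. \<forall>\<xi>. profile_quantity \<Omega> a x X\<^sub>0 \<xi> = d)"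
proof -
  let ?Q = "profile_quantity \<Omega> a x X\<^sub>0"
  let ?D = "\<lambda>\<xi>. cross3 (x \<xi>) (vderiv (vderiv x) \<xi>) - \<Omega> *\<^sub>R cross3 e3 (x \<xi>) + a *\<^sub>R vderiv x \<xi>"
  note x' = smooth_curve_has_vector_derivative[OF x, of 0, simplified]
  note x'' = smooth_curve_has_vector_derivative[OF x, of 1, simplified]
  have "((\<lambda>\<xi>. cross3 (x \<xi>) (vderiv x \<xi>)) has_vector_derivative
          cross3 (x \<xi>) (vderiv (vderiv x) \<xi>)) (at \<xi>)" for \<xi>
    \<comment> \<open>The other term of the product rule is x' \<times> x' = 0.\<close>
    using has_vector_derivative_cross3[OF x' x''] by simp
  moreover have "((\<lambda>\<xi>. cross3 e3 (X\<^sub>0 \<xi>)) has_vector_derivative cross3 e3 (x \<xi>)) (at \<xi>)" for \<xi>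
    using has_vector_derivative_cross3[OF has_vector_derivative_const X\<^sub>0, of e3] by simp
  ultimately have Q: "(?Q has_vector_derivative ?D \<xi>) (at \<xi>)" for \<xi>
    unfolding profile_quantity_def
    by (intro has_vector_derivative_add has_vector_derivative_diff x'
        bounded_linear.has_vector_derivative[OF bounded_linear_scaleR_right])
  show ?thesis
  proof
    assume "profile_eq \<Omega> a x"
    with Q have "(?Q has_vector_derivative 0) (at \<xi> within UNIV)" for \<xi>
      by (metis profile_eq_def)
    then show "\<exists>d. \<forall>\<xi>. ?Q \<xi> = d"
      using has_vector_derivative_zero_constant[of UNIV ?Q] by (metis convex_UNIV UNIV_I)
  next
    assume "\<exists>d. \<forall>\<xi>. ?Q \<xi> = d"
    then obtain d where "?Q = (\<lambda>_. d)"
      by blast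
    with Q show "profile_eq \<Omega> a x"
      unfolding profile_eq_def
      using vector_derivative_unique_at has_vector_derivative_const by metis
  qed
qed

theorem proposition6p1:
  fixes \<Omega> a :: real
    and x X\<^sub>0 :: "real \<Rightarrow> real ^ 3"
  assumes "smooth_curve x"
    and "\<forall>\<xi>. x \<xi> \<in> sphere 0 1"
    and "\<forall>\<xi>. (X\<^sub>0 has_vector_derivative x \<xi>) (at \<xi>)"
  shows
    "(profile_eq \<Omega> a x \<longrightarrow>
        (\<exists>d. (\<forall>\<xi>. profile_quantity \<Omega> a x X\<^sub>0 \<xi> = d) \<and>
             (\<forall>b. (\<forall>t. (b has_vector_derivative rot3 (\<Omega> * t) d) (at t)) \<longrightarrow>
                  solves_VFE (filament \<Omega> a X\<^sub>0 b) \<and>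
                  (\<forall>t s. ((\<lambda>s'. filament \<Omega> a X\<^sub>0 b t s')
                            has_vector_derivative rot3 (\<Omega> * t) (x (s - a * t))) (at s)))))
     \<and>
     (\<forall>b :: real \<Rightarrow> real ^ 3.
        solves_VFE (filament \<Omega> a X\<^sub>0 b) \<longrightarrow>
          (\<exists>d. \<forall>\<xi>. profile_quantity \<Omega> a x X\<^sub>0 \<xi> = d \<and>
                   (X\<^sub>0 has_vector_derivative x \<xi>) (at \<xi>)) \<and>
          profile_eq \<Omega> a x)"
proof -
  have X\<^sub>0: "(X\<^sub>0 has_vector_derivative x \<xi>) (at \<xi>)" for \<xi>
    using assms(3) by blast
  note VFE_iff = solves_VFE_filament_iff[
      OF smooth_curve_has_vector_derivative[OF assms(1), of 0, simplified] X\<^sub>0]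
  note Q_iff = profile_quantity_constant_iff[OF assms(1) X\<^sub>0, of \<Omega> a]
  show ?thesis
  proof (intro conjI impI allI)
    assume "profile_eq \<Omega> a x"
    then obtain d where d: "\<forall>\<xi>. profile_quantity \<Omega> a x X\<^sub>0 \<xi> = d"
      using Q_iff by blast
    show "\<exists>d. (\<forall>\<xi>. profile_quantity \<Omega> a x X\<^sub>0 \<xi> = d) \<and>
             (\<forall>b. (\<forall>t. (b has_vector_derivative rot3 (\<Omega> * t) d) (at t)) \<longrightarrow>
                  solves_VFE (filament \<Omega> a X\<^sub>0 b) \<and>
                  (\<forall>t s. ((\<lambda>s'. filament \<Omega> a X\<^sub>0 b t s')
                            has_vector_derivative rot3 (\<Omega> * t) (x (s - a * t))) (at s)))"
      \<comment> \<open>Once the quantity equals \<open>d\<close>, the condition on \<open>b\<close>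
        is the right-hand side of \<open>VFE_iff\<close>.\<close>
      using d filament_has_space_derivative[OF X\<^sub>0] by (intro exI[of _ d]) (simp add: VFE_iff)
  next
    fix b
    assume "solves_VFE (filament \<Omega> a X\<^sub>0 b)"
    then have "(b has_vector_derivative rot3 (\<Omega> * 0) (profile_quantity \<Omega> a x X\<^sub>0 \<xi>)) (at 0)" for \<xi>
      unfolding VFE_iff by blast
    \<comment> \<open>The constant is b'(0): the rotation at time 0 is the identity, and
      \<open>b\<close> has only one derivative there.\<close>
    then have "\<exists>d. \<forall>\<xi>. profile_quantity \<Omega> a x X\<^sub>0 \<xi> = d"
      using vector_derivative_unique_at by (metis mult_zero_right rot3_0)
    then show "\<exists>d. \<forall>\<xi>. profile_quantity \<Omega> a x X\<^sub>0 \<xi> = d \<and> (X\<^sub>0 has_vector_derivative x \<xi>) (at \<xi>)"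
      and "profile_eq \<Omega> a x"
      using X\<^sub>0 Q_iff by blast+
  qed
qed

end
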